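(* Let $\alpha\ne 0$ be a complex number and let $q_i$ $(i=1,2)$ be convex univalent in $\mathbb{D}$ with $q_i(0)=1$. Define $$h_i(z):=\alpha q_i^2(z)+(1-\alpha)q_i(z)+\alpha zq_i'(z)\quad(i=1,2),$$ and suppose that $$\operatorname{Re}\left(\frac{1-\alpha}{\alpha}+2q_i(z)\right)>0\quad(i=1,2;\ z\in\mathbb{D}).$$ Let $f\in\mathcal{A}$, and let $\Phi$ be analytic in a domain containing $f(\mathbb{D})$ with $\Phi(0)=0$, $\Phi'(0)=1$ and $\Phi(\omega)\ne 0$ for $\omega\in f(\mathbb{D})\setminus\{0\}$. If $\frac{zf'(z)}{\Phi(f(z))}\in\mathcal{H}[1,1]\cap\mathcal{Q}$ and $$\frac{zf'(z)}{\Phi(f(z))}\left(1+\frac{\alpha zf''(z)}{f'(z)}+\frac{\alpha z\,(f'(z)-(\Phi(f(z)))')}{\Phi(f(z))}\right)$$ is univalent in $\mathbb{D}$, then $$h_1(z)\prec\frac{zf'(z)}{\Phi(f(z))}\left(1+\frac{\alpha zf''(z)}{f'(z)}+\frac{\alpha z\,(f'(z)-(\Phi(f(z)))')}{\Phi(f(z))}\right)\prec h_2(z)$$ implies $$q_1(z)\prec\frac{zf'(z)}{\Phi(f(z))}\prec q_2(z).$$ Further, $q_1$ and $q_2$ are respectively the best subordinant and the best dominant.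
   Context: $\mathbb{D}=\{z\in\mathbb{C}:|z|<1\}$; $\mathcal{H}$ is the class of analytic functions in $\mathbb{D}$; $\mathcal{H}[1,1]=\{f\in\mathcal{H}:f(0)=1\}$; $\mathcal{A}=\{f\in\mathcal{H}:f(0)=0,\ f'(0)=1\}$. Univalent means analytic and injective; convex univalent means univalent with convex image. For $f,g\in\mathcal{H}$, $f\prec g$ ($f$ is subordinate to $g$) means there is an analytic $w:\mathbb{D}\to\mathbb{D}$ with $w(0)=0$ and $f(z)=g(w(z))$ for all $z\in\mathbb{D}$. $(\Phi(f(z)))'$ denotes the derivative of $z\mapsto\Phi(f(z))$. All quotients are understood after removing removable singularities (in particular at $z=0$, and for the product with $zf'(z)$ at zeros of $f'$). $\mathcal{Q}$ is the set of all functions $f$ that are analytic and injective on $\overline{\mathbb{D}}\setminus E(f)$, where $E(f)=\{\zeta\in\partial\mathbb{D}:\lim_{z\to\zeta}f(z)=\infty\}$, and are such that $f'(\zeta)\ne 0$ for $\zeta\in\partial\mathbb{D}\setminus E(f)$. Best dominant and best subordinant: for analytic $p$ in $\mathbb{D}$ with $p(0)=1$ put $\Psi[p](z)=\alpha p^2(z)+(1-\alpha)p(z)+\alpha zp'(z)$ (with $p(z)=zf'(z)/\Phi(f(z))$ this is the middle expression of the double subordination). A univalent function $\tilde q$ is a dominant of $\Psi[p]\prec h_2$ if $p\prec\tilde q$ for every such $p$ satisfying it; the best dominant is a dominant $q$ with $q\prec\tilde q$ for every dominant $\tilde q$. An analytic function $\tilde q$ is a subordinant of $h_1\prec\Psi[p]$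 if $\tilde q\prec p$ for every $p$ with $p(0)=1$ such that $p$ and $\Psi[p]$ are univalent in $\mathbb{D}$ and $h_1\prec\Psi[p]$; the best subordinant is a univalent subordinant $q$ with $\tilde q\prec q$ for every subordinant $\tilde q$. *)

theory Defs
  imports "HOL-Complex_Analysis.Complex_Analysis"
begin

abbreviation unit_disc :: "complex set" where
  "unit_disc \<equiv> ball 0 1"

definition class_H11 :: "(complex \<Rightarrow> complex) set" where
  "class_H11 = {f. f holomorphic_on unit_disc \<and> f 0 = 1}"

definition class_A :: "(complex \<Rightarrow> complex) set" where
  "class_A = {f. f holomorphic_on unit_disc \<and> f 0 = 0 \<and> deriv f 0 = 1}"

definition univalent :: "(complex \<Rightarrow> complex) \<Rightarrow> bool" where
  "univalent f \<longleftrightarrow> f holomorphic_on unit_disc \<and> inj_on f unit_disc"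

definition convex_univalent :: "(complex \<Rightarrow> complex) \<Rightarrow> bool" where
  "convex_univalent f \<longleftrightarrow> univalent f \<and> convex (f ` unit_disc)"

text \<open>Subordination is only used between functions that are analytic in the disc;
  analyticity is required separately wherever it is not automatic.\<close>

definition subordinate :: "(complex \<Rightarrow> complex) \<Rightarrow> (complex \<Rightarrow> complex) \<Rightarrow> bool"
    (infix "\<prec>" 50) where
  "f \<prec> g \<longleftrightarrow> (\<exists>w. w holomorphic_on unit_disc \<and> w ` unit_disc \<subseteq> unit_disc \<and> w 0 = 0 \<and>
                  (\<forall>z\<in>unit_disc. f z = g (w z)))"

definition exceptional_set :: "(complex \<Rightarrow> complex) \<Rightarrow> complex set" where
  "exceptional_set f = {\<zeta> \<in> sphere 0 1. filterlim f at_infinity (at \<zeta> within unit_disc)}"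

text \<open>A function given on the open disc belongs to the class Q if it extends to the closed
  disc minus its exceptional set with the required properties. The function \<open>F\<close> is such an
  extension: it is determined by \<open>f\<close> on the closed disc minus the exceptional set, and
  \<open>exceptional_set F = exceptional_set f\<close>, as that set only depends on values in the open disc.\<close>

definition class_Q :: "(complex \<Rightarrow> complex) set" where
  "class_Q = {f. \<exists>F. (\<forall>z\<in>unit_disc. F z = f z) \<and>
                   F analytic_on (cball 0 1 - exceptional_set F) \<and>
                   inj_on F (cball 0 1 - exceptional_set F) \<and>
                   (\<forall>\<zeta>\<in>sphere 0 1 - exceptional_set F. deriv F \<zeta> \<noteq> 0)}"

text \<open>In the next two definitions, \<^const>\<open>remove_sings\<close> replaces the value at a point by the
  limit there. This takes care of \<open>z = 0\<close> and, in the second one, of the zeros of \<open>f'\<close>, where the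
  pole of \<open>f''/f'\<close> is cancelled by the factor \<open>z f'\<close>. At a pole the result is \<open>0\<close>, which is not the
  limit, so the result is not holomorphic on a neighbourhood of a pole.\<close>

definition quot_expr ::
    "(complex \<Rightarrow> complex) \<Rightarrow> (complex \<Rightarrow> complex) \<Rightarrow> complex \<Rightarrow> complex" where
  "quot_expr \<Phi> f = remove_sings (\<lambda>z. z * deriv f z / \<Phi> (f z))"

definition middle_expr ::
    "complex \<Rightarrow> (complex \<Rightarrow> complex) \<Rightarrow> (complex \<Rightarrow> complex) \<Rightarrow> complex \<Rightarrow> complex" where
  "middle_expr \<alpha> \<Phi> f = remove_sings (\<lambda>z.
     z * deriv f z / \<Phi> (f z) *
       (1 + \<alpha> * z * deriv (deriv f) z / deriv f z
          + \<alpha> * z * (deriv f z - deriv (\<lambda>\<zeta>. \<Phi> (f \<zeta>)) z) / \<Phi> (f z)))"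

definition Psi :: "complex \<Rightarrow> (complex \<Rightarrow> complex) \<Rightarrow> complex \<Rightarrow> complex" where
  "Psi \<alpha> p = (\<lambda>z. \<alpha> * (p z)\<^sup>2 + (1 - \<alpha>) * p z + \<alpha> * z * deriv p z)"

definition dominant :: "complex \<Rightarrow> (complex \<Rightarrow> complex) \<Rightarrow> (complex \<Rightarrow> complex) \<Rightarrow> bool" where
  "dominant \<alpha> h q \<longleftrightarrow> univalent q \<and>
     (\<forall>p. p holomorphic_on unit_disc \<and> p 0 = 1 \<and> Psi \<alpha> p \<prec> h \<longrightarrow> p \<prec> q)"

definition best_dominant :: "complex \<Rightarrow> (complex \<Rightarrow> complex) \<Rightarrow> (complex \<Rightarrow> complex) \<Rightarrow> bool" where
  "best_dominant \<alpha> h q \<longleftrightarrow> dominant \<alpha> h q \<and> (\<forall>r. dominant \<alpha> h r \<longrightarrow> q \<prec> r)"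

definition subordinant :: "complex \<Rightarrow> (complex \<Rightarrow> complex) \<Rightarrow> (complex \<Rightarrow> complex) \<Rightarrow> bool" where
  "subordinant \<alpha> h q \<longleftrightarrow> q holomorphic_on unit_disc \<and>
     (\<forall>p. p 0 = 1 \<and> univalent p \<and> univalent (Psi \<alpha> p) \<and> h \<prec> Psi \<alpha> p \<longrightarrow> q \<prec> p)"

definition best_subordinant ::
    "complex \<Rightarrow> (complex \<Rightarrow> complex) \<Rightarrow> (complex \<Rightarrow> complex) \<Rightarrow> bool" where
  "best_subordinant \<alpha> h q \<longleftrightarrow> univalent q \<and> subordinant \<alpha> h q \<and> (\<forall>r. subordinant \<alpha> h r \<longrightarrow> r \<prec> q)"

end

theory Submission
  imports Defs
begin

text \<open>
  Write \<open>\<Psi>[p] = \<alpha> p\<^sup>2 + (1 - \<alpha>) p + \<alpha> z p'\<close> and \<open>h = \<Psi>[q]\<close>. If \<open>p\<close> is not subordinate to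
  \<open>q\<close>, Jack's lemma applied to \<open>q\<^sup>-\<^sup>1 \<circ> p\<close> at the first point \<open>z\<^sub>0\<close> where \<open>p\<close> leaves the image of
  a smaller disc gives \<open>p(z\<^sub>0) = q(\<zeta>\<^sub>0)\<close> and \<open>z\<^sub>0 p'(z\<^sub>0) = m \<zeta>\<^sub>0 q'(\<zeta>\<^sub>0)\<close> with \<open>m \<ge> 1\<close>. So
  \<open>\<Psi>[p](z\<^sub>0)\<close> lies on the outer ray \<open>h(\<zeta>\<^sub>0) + s \<alpha> \<zeta>\<^sub>0 q'(\<zeta>\<^sub>0)\<close>, \<open>s \<ge> 0\<close>, which never meets the
  values of \<open>h\<close> on the disc \<open>|z| < |\<zeta>\<^sub>0|\<close>. For the other subordination the roles of \<open>p\<close> and \<open>q\<close>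
  are exchanged; then \<open>\<Psi>[p](\<zeta>\<^sub>0)\<close> lies on an inner segment \<open>h(z\<^sub>0) - s \<alpha> z\<^sub>0 q'(z\<^sub>0)\<close>,
  \<open>0 \<le> s < 1\<close>, which stays inside the image of \<open>|z| \<le> |z\<^sub>0|\<close> under \<open>h\<close>.

  Both facts about the ray rest on the inequality \<open>Re (\<zeta> q'(\<zeta>) / (q(\<zeta>) - q(z))) \<ge> 0\<close> for
  \<open>|z| \<le> |\<zeta>|\<close>, which expresses that the convex image of every smaller disc has a supporting line at
  each boundary point. They are proved on arbitrary discs of radius \<open>r < 1\<close>, so that no
  boundary regularity of \<open>p\<close> or \<open>q\<close> is needed.
\<close>

subsection \<open>Derivatives along curves\<close>

lemma Re_inverse_nonneg_iff: "0 \<le> Re (inverse w) \<longleftrightarrow> 0 \<le> Re w"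
proof (cases "w = 0")
  case False
  then have "(Re w)\<^sup>2 + (Im w)\<^sup>2 > 0" by (simp add: complex_neq_0)
  then show ?thesis by (simp add: zero_le_divide_iff)
qed simp

lemma Re_inverse_pos_iff: "0 < Re (inverse w) \<longleftrightarrow> 0 < Re w"
proof (cases "w = 0")
  case False
  then have "(Re w)\<^sup>2 + (Im w)\<^sup>2 > 0" by (simp add: complex_neq_0)
  then show ?thesis by (simp add: zero_less_divide_iff)
qed simp

lemma Re_has_derivative_along_curve:
  assumes F: "(F has_field_derivative D) (at (c t))"
    and c: "(c has_vector_derivative v) (at t)"
  shows "((\<lambda>s::real. Re (F (c s))) has_real_derivative Re (D * v)) (at t)"
proof -
  have "((F \<circ> c) has_vector_derivative (v * D)) (at t)"
    by (rule field_vector_diff_chain_at[OF c F])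
  then have "((\<lambda>s. Re ((F \<circ> c) s)) has_vector_derivative Re (v * D)) (at t)"
    by (rule bounded_linear.has_vector_derivative[OF bounded_linear_Re])
  then show ?thesis
    by (simp add: has_real_derivative_iff_has_vector_derivative o_def mult.commute)
qed

lemma Re_has_derivative_along_line:
  assumes "(F has_field_derivative D) (at a)"
  shows "((\<lambda>t::real. Re (F (a + of_real t * v))) has_real_derivative Re (D * v)) (at 0)"
proof (rule Re_has_derivative_along_curve[where c="\<lambda>t. a + of_real t * v"])
  have "((\<lambda>t. a + t *\<^sub>R v) has_vector_derivative v) (at (0::real))"
    by (auto intro!: derivative_eq_intros)
  then show "((\<lambda>t. a + of_real t * v) has_vector_derivative v) (at (0::real))"
    by (simp add: scaleR_conv_of_real)
qed (use assms in simp)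

text \<open>The bounds it is applied to come from the Schwarz lemma and concern one direction only,
  so just \<open>t > 0\<close> is compared and just the sign of the derivative follows.\<close>

lemma DERIV_right_max_nonpos:
  fixes k :: "real \<Rightarrow> real"
  assumes "(k has_real_derivative l) (at 0)"
    and "\<And>t. 0 < t \<Longrightarrow> t < 1 \<Longrightarrow> k t \<le> k 0"
  shows "l \<le> 0"
proof (rule ccontr)
  assume "\<not> l \<le> 0"
  then obtain d where d: "d > 0" "\<And>h. h > 0 \<Longrightarrow> h < d \<Longrightarrow> k 0 < k (0 + h)"
    using DERIV_pos_inc_right[OF assms(1)] by auto
  define h where "h = min (d/2) (1/2)"
  have "0 < h" "h < d" "h < 1" using d(1) by (auto simp: h_def min_def)
  then show False using d(2)[of h] assms(2)[of h] by simp
qed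

subsection \<open>Subordination and the first exit point\<close>

text \<open>The Schwarz lemma controls \<open>v\<close> along the radius to \<open>z0\<close>, which
  gives \<open>Re (z0 v'(z0) / v(z0)) \<ge> 1\<close>. On the circle \<open>norm (v z)\<close> is
  largest at \<open>z0\<close>, so the tangential derivative vanishes and the quotient is
  real.\<close>

lemma Jack_lemma:
  assumes holf: "v holomorphic_on U" and "open U" "cball 0 \<rho> \<subseteq> U"
    and v0: "v 0 = 0"
    and lt: "\<And>z. norm z < \<rho> \<Longrightarrow> norm (v z) < norm (v z0)"
    and z0: "norm z0 = \<rho>" "\<rho> > 0"
  obtains m :: real where "m \<ge> 1" "z0 * deriv v z0 = of_real m * v z0"
proof -
  define r where "r = norm (v z0)"
  have "r > 0" using lt[of 0] z0 v0 by (auto simp: r_def)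
  then have vz0: "v z0 \<noteq> 0" by (auto simp: r_def)
  have z0U: "z0 \<in> U" using assms by auto
  define F where "F = (\<lambda>z. v z / v z0)"
  define D where "D = deriv v z0 / v z0"
  have dF: "(F has_field_derivative D) (at z0)"
    unfolding F_def D_def
    using holomorphic_derivI[OF holf \<open>open U\<close> z0U] by (rule DERIV_cdivide)
  \<comment> \<open>Rescaling: \<open>x \<mapsto> v(\<rho> x) / r\<close> maps the unit disc into
    itself and fixes \<open>0\<close>.\<close>
  have Schwarz: "norm (v (of_real \<rho> * x)) \<le> r * norm x" if x: "norm x < 1" for x
  proof -
    have "(\<lambda>x. v (of_real \<rho> * x) / of_real r) holomorphic_on ball 0 1"
    proof -
      have "v \<circ> (\<lambda>x. of_real \<rho> * x) holomorphic_on ball 0 1"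
        by (rule holomorphic_on_compose_gen[OF _ holf])
          (use assms in \<open>auto intro!: holomorphic_intros simp: norm_mult subset_iff\<close>)
      then show ?thesis using \<open>r > 0\<close>
        by (auto intro!: holomorphic_intros simp: o_def)
    qed
    moreover have "norm (v (of_real \<rho> * y) / of_real r) < 1" if "norm y < 1" for y
      using lt[of "of_real \<rho> * y"] that \<open>r > 0\<close> z0
      by (auto simp: norm_mult norm_divide r_def)
    ultimately have "norm (v (of_real \<rho> * x) / of_real r) \<le> norm x"
      using Schwarz_Lemma(1)[of "\<lambda>x. v (of_real \<rho> * x) / of_real r" x] v0 x by simp
    then show ?thesis using \<open>r > 0\<close> by (simp add: norm_divide field_simps)
  qed
  \<comment> \<open>Going inwards along the radius, \<open>Re F \<le> 1 - t\<close>, with equality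
    at \<open>t = 0\<close>.\<close>
  have "((\<lambda>t::real. Re (F (z0 + of_real t * (- z0)))) has_real_derivative Re (D * (- z0))) (at 0)"
    by (rule Re_has_derivative_along_line[OF dF])
  then have "((\<lambda>t::real. Re (F (z0 + of_real t * (- z0))) + t) has_real_derivative Re (D * (- z0)) + 1) (at 0)"
    by (intro DERIV_add DERIV_ident)
  then have "Re (D * (- z0)) + 1 \<le> 0"
  proof (rule DERIV_right_max_nonpos)
    fix t :: real assume t: "0 < t" "t < 1"
    have "norm (of_real (1-t) * z0 / of_real \<rho>) = 1 - t"
      using t z0 by (simp add: norm_mult norm_divide del: of_real_diff)
    then have "norm (v (of_real \<rho> * (of_real (1-t) * z0 / of_real \<rho>))) \<le> r * (1 - t)"
      using Schwarz[of "of_real (1-t) * z0 / of_real \<rho>"] t by simp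
    moreover have "of_real \<rho> * (of_real (1-t) * z0 / of_real \<rho>) = z0 + of_real t * (- z0)"
      using z0 by (simp add: left_diff_distrib mult.assoc)
    ultimately have "norm (v (z0 + of_real t * (- z0))) \<le> r * (1 - t)"
      by simp
    then have "norm (F (z0 + of_real t * (- z0))) \<le> 1 - t"
      using \<open>r > 0\<close> by (simp add: F_def norm_divide pos_divide_le_eq mult.commute flip: r_def)
    then show "Re (F (z0 + of_real t * (- z0))) + t \<le> Re (F (z0 + of_real 0 * (- z0))) + 0"
      using complex_Re_le_cmod[of "F (z0 + of_real t * (- z0))"] vz0 by (simp add: F_def)
  qed
  then have re: "Re (z0 * D) \<ge> 1" by (simp add: algebra_simps)
  have le: "norm (v z) \<le> r" if "norm z = \<rho>" for z
  proof -
    have "z \<in> closure (ball 0 \<rho>)" using that z0 by simp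
    moreover have "v ` closure (ball 0 \<rho>) \<subseteq> cball 0 r"
    proof (rule image_closure_subset)
      show "continuous_on (closure (ball 0 \<rho>)) v"
        using holomorphic_on_imp_continuous_on[OF holf] assms(3) z0
        by (auto intro: continuous_on_subset)
      show "v ` ball 0 \<rho> \<subseteq> cball 0 r" using lt by (force simp: r_def)
    qed auto
    ultimately show ?thesis by auto
  qed
  \<comment> \<open>Along the circle \<open>Re F\<close> has its maximum \<open>1\<close> at
    \<open>t = 0\<close>; the derivative there is \<open>- Im (z0 * D)\<close>.\<close>
  have "((\<lambda>t::real. Re (F (z0 * cis t))) has_real_derivative Re (D * (z0 * \<i>))) (at 0)"
  proof (rule Re_has_derivative_along_curve[where c="\<lambda>t. z0 * cis t"])
    show "(F has_field_derivative D) (at (z0 * cis 0))" using dF by simp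
    show "((\<lambda>t. z0 * cis t) has_vector_derivative z0 * \<i>) (at 0)"
      unfolding has_vector_derivative_def
      by (auto intro!: derivative_eq_intros simp: algebra_simps scaleR_conv_of_real)
  qed
  then have "Re (D * (z0 * \<i>)) = 0"
  proof (rule DERIV_local_max[where d=1])
    show "\<forall>y. \<bar>0 - y\<bar> < 1 \<longrightarrow> Re (F (z0 * cis y)) \<le> Re (F (z0 * cis 0))"
    proof (intro allI impI)
      fix y :: real
      have "norm (F (z0 * cis y)) \<le> 1"
        using le[of "z0 * cis y"] z0 \<open>r > 0\<close> by (simp add: F_def norm_divide norm_mult flip: r_def)
      then show "Re (F (z0 * cis y)) \<le> Re (F (z0 * cis 0))"
        using complex_Re_le_cmod[of "F (z0 * cis y)"] vz0 by (simp add: F_def)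
    qed
  qed auto
  then have "Im (z0 * D) = 0" by (simp add: algebra_simps)
  then have "z0 * D = of_real (Re (z0 * D))" by (simp add: complex_eq_iff)
  then have "z0 * deriv v z0 = of_real (Re (z0 * D)) * v z0"
    using vz0 by (simp add: D_def field_simps)
  with re that show thesis by blast
qed

lemma univalent_inverse:
  fixes q :: "complex \<Rightarrow> complex"
  defines "g \<equiv> the_inv_into unit_disc q"
  assumes q: "univalent q"
  shows "g holomorphic_on q ` unit_disc"
    and "\<And>z. z \<in> unit_disc \<Longrightarrow> g (q z) = z"
    and "\<And>z. z \<in> unit_disc \<Longrightarrow> deriv q z \<noteq> 0"
    and "\<And>z. z \<in> unit_disc \<Longrightarrow> (g has_field_derivative inverse (deriv q z)) (at (q z))"
    and "open (q ` unit_disc)"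
proof -
  have holq: "q holomorphic_on unit_disc" and inj: "inj_on q unit_disc"
    using q by (auto simp: univalent_def)
  show g: "g (q z) = z" if "z \<in> unit_disc" for z
    unfolding g_def by (rule the_inv_into_f_f[OF inj that])
  show op: "open (q ` unit_disc)"
    by (rule open_mapping_thm3[OF holq open_ball inj])
  obtain k where k: "k holomorphic_on q ` unit_disc"
    "\<And>z. z \<in> unit_disc \<Longrightarrow> deriv q z * deriv k (q z) = 1"
    "\<And>z. z \<in> unit_disc \<Longrightarrow> k (q z) = z"
    using holomorphic_has_inverse[OF holq open_ball inj] by metis
  show holg: "g holomorphic_on q ` unit_disc"
    by (rule holomorphic_transform[OF k(1)]) (auto simp: k(3) g)
  show nz: "deriv q z \<noteq> 0" if "z \<in> unit_disc" for z
    using k(2)[OF that] by auto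
  show "(g has_field_derivative inverse (deriv q z)) (at (q z))" if z: "z \<in> unit_disc" for z
  proof -
    have "(k has_field_derivative deriv k (q z)) (at (q z))"
      by (rule holomorphic_derivI[OF k(1) op]) (use z in simp)
    moreover have "deriv k (q z) = inverse (deriv q z)"
      using inverse_unique[OF k(2)[OF z]] by simp
    moreover have "\<forall>\<^sub>F w in nhds (q z). k w = g w"
      using op z k(3) g by (auto simp: eventually_nhds intro!: exI[of _ "q ` unit_disc"])
    ultimately show ?thesis
      using DERIV_cong_ev[OF refl _ refl, of k g "q z"] by simp
  qed
qed

lemma subordinate_univalentI:
  fixes p q :: "complex \<Rightarrow> complex"
  assumes "univalent q" "p holomorphic_on unit_disc" "p ` unit_disc \<subseteq> q ` unit_disc" "p 0 = q 0"
  shows "p \<prec> q"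
proof -
  define g where "g = the_inv_into unit_disc q"
  note g = univalent_inverse[OF assms(1), folded g_def]
  have "g \<circ> p holomorphic_on unit_disc"
    by (rule holomorphic_on_compose_gen[OF assms(2) g(1)]) (use assms(3) in auto)
  moreover have "g (p z) \<in> unit_disc \<and> p z = q (g (p z))" if "z \<in> unit_disc" for z
  proof -
    obtain y where "y \<in> unit_disc" "p z = q y"
      using subsetD[OF assms(3) imageI[OF \<open>z \<in> unit_disc\<close>]] by (elim imageE) simp
    then show ?thesis using g(2)[of y] by auto
  qed
  moreover have "g (p 0) = 0" using g(2)[of 0] assms(4) by simp
  ultimately show ?thesis
    unfolding subordinate_def by (intro exI[of _ "g \<circ> p"]) auto
qed

text \<open>The gain over the definition is \<open>norm y \<le> norm z\<close>, which makes
  subordination a statement about every smaller disc.\<close>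

lemma subordinate_Schwarz:
  fixes p q :: "complex \<Rightarrow> complex"
  assumes "p \<prec> q" "z \<in> unit_disc"
  obtains y where "norm y \<le> norm z" "p z = q y"
proof -
  obtain w where w: "w holomorphic_on unit_disc" "w ` unit_disc \<subseteq> unit_disc" "w 0 = 0"
    "\<forall>z\<in>unit_disc. p z = q (w z)"
    using assms(1) by (auto simp: subordinate_def)
  have "norm (w z) \<le> norm z"
    by (rule Schwarz_Lemma(1)[OF w(1,3)]) (use w(2) assms(2) in \<open>force+\<close>)
  then show thesis using that w(4) assms(2) by blast
qed

lemma subordinate_cong:
  fixes p p' q q' :: "complex \<Rightarrow> complex"
  assumes "\<And>z. z \<in> unit_disc \<Longrightarrow> p z = p' z" "\<And>z. z \<in> unit_disc \<Longrightarrow> q z = q' z"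
  shows "p \<prec> q \<longleftrightarrow> p' \<prec> q'"
  using assms by (auto simp: subordinate_def image_subset_iff)

text \<open>Each point of the unit disc lies in a disc of radius \<open>r < 1\<close>, so the exit
  argument only has to be run on such discs.\<close>

lemma univalent_subset_if_balls:
  fixes p q :: "complex \<Rightarrow> complex"
  assumes "\<And>r. 0 < r \<Longrightarrow> r < 1 \<Longrightarrow> p ` ball 0 r \<subseteq> q ` ball 0 r"
  shows "p ` unit_disc \<subseteq> q ` unit_disc"
proof
  fix w assume "w \<in> p ` unit_disc"
  then obtain z where z: "norm z < 1" "w = p z" by auto
  define r where "r = (norm z + 1) / 2"
  have r: "0 < r" "r < 1" "norm z < r" using z norm_ge_zero[of z] by (auto simp: r_def simp del: norm_ge_zero)
  then have "w \<in> q ` ball 0 r" using assms[of r] z by auto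
  then show "w \<in> q ` unit_disc" using r by auto
qed

text \<open>Among the points that \<open>p\<close> sends outside the image of
  \<open>ball 0 r\<close> under \<open>q\<close>, \<open>z0\<close> has least modulus in a closed
  disc. The function \<open>g \<circ> p\<close> has modulus below \<open>r\<close> before
  \<open>z0\<close> and equal to \<open>r\<close> at \<open>z0\<close>, so Jack's lemma applies; the
  chain rule turns its conclusion into one about \<open>p\<close> and \<open>q\<close>.\<close>

lemma first_exit_point:
  assumes p: "p holomorphic_on unit_disc" and q: "univalent q" and "p 0 = q 0"
    and r: "0 < r" "r < 1" and out: "\<not> p ` ball 0 r \<subseteq> q ` ball 0 r"
  obtains z0 \<zeta>0 and m :: real where "0 < norm z0" "norm z0 < r" "norm \<zeta>0 = r" "p z0 = q \<zeta>0" "m \<ge> 1"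
    "z0 * deriv p z0 = of_real m * (\<zeta>0 * deriv q \<zeta>0)"
proof -
  have holq: "q holomorphic_on unit_disc" and injq: "inj_on q unit_disc"
    using q by (simp_all add: univalent_def)
  have contp: "continuous_on unit_disc p" and contq: "continuous_on unit_disc q"
    using p holq by (auto intro: holomorphic_on_imp_continuous_on)
  define g where "g = the_inv_into unit_disc q"
  note g = univalent_inverse[OF q, folded g_def]
  have qr: "open (q ` ball 0 r)"
  proof (rule open_mapping_thm3)
    have "ball 0 r \<subseteq> unit_disc" using r by (simp add: subset_ball)
    then show "q holomorphic_on ball 0 r" "inj_on q (ball 0 r)"
      by (rule holomorphic_on_subset[OF holq], rule inj_on_subset[OF injq])
  qed simp
  obtain z1 where z1: "norm z1 < r" "p z1 \<notin> q ` ball 0 r"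
    using out by (metis image_subsetI mem_ball_0)
  \<comment> \<open>Restricting to the closed disc through \<open>z1\<close> makes the set compact,
    so that a point of least modulus exists.\<close>
  define K where "K = cball 0 (norm z1) \<inter> p -` (- (q ` ball 0 r))"
  have "closed K" unfolding K_def
    by (rule continuous_closed_preimage)
      (use z1 r qr in \<open>auto intro: continuous_on_subset[OF contp]\<close>)
  then have "compact K" by (auto simp: K_def compact_eq_bounded_closed intro: bounded_subset[of "cball 0 (norm z1)"])
  moreover have "z1 \<in> K" using z1 by (auto simp: K_def)
  ultimately obtain z0 where z0: "z0 \<in> K" and min: "\<And>z. z \<in> K \<Longrightarrow> norm z0 \<le> norm z"
    using continuous_attains_inf[of K norm] continuous_on_norm_id by blast
  have z0r: "norm z0 < r" using min[OF \<open>z1 \<in> K\<close>] z1 by simp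
  have z0D: "z0 \<in> unit_disc" using z0r r by simp
  have inside: "p z \<in> q ` ball 0 r" if "norm z < norm z0" for z
    using min[of z] that z0 by (force simp: K_def)
  have "z0 \<noteq> 0" using z0 \<open>p 0 = q 0\<close> r by (auto simp: K_def)
  have cl: "closed (q ` cball 0 r)"
    by (intro compact_imp_closed compact_continuous_image continuous_on_subset[OF contq])
      (use r in auto)
  have insidec: "p z \<in> q ` cball 0 r" if "norm z \<le> norm z0" for z
  proof -
    have "z \<in> closure (ball 0 (norm z0))" using that \<open>z0 \<noteq> 0\<close> by simp
    moreover have "p ` closure (ball 0 (norm z0)) \<subseteq> q ` cball 0 r"
    proof (rule image_closure_subset)
      show "continuous_on (closure (ball 0 (norm z0))) p"
        by (rule continuous_on_subset[OF contp]) (use z0D \<open>z0 \<noteq> 0\<close> in auto)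
      show "p ` ball 0 (norm z0) \<subseteq> q ` cball 0 r" using inside by fastforce
    qed (rule cl)
    ultimately show ?thesis by blast
  qed
  obtain \<zeta>0 where \<zeta>0: "p z0 = q \<zeta>0" "norm \<zeta>0 \<le> r" using insidec[of z0] by auto
  with z0 have \<zeta>r: "norm \<zeta>0 = r" by (force simp: K_def)
  have \<zeta>D: "\<zeta>0 \<in> unit_disc" using \<zeta>r r by simp
  \<comment> \<open>\<open>p\<close> may leave the image of \<open>q\<close> elsewhere, so
    \<open>g \<circ> p\<close> is considered on an open set that contains the closed disc of radius
    \<open>norm z0\<close>.\<close>
  define U where "U = unit_disc \<inter> p -` (q ` unit_disc)"
  have "open U" unfolding U_def
    by (rule continuous_open_preimage[OF contp _ g(5)]) auto
  define v where "v = g \<circ> p"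
  have holv: "v holomorphic_on U" unfolding v_def
    by (rule holomorphic_on_compose_gen[OF holomorphic_on_subset[OF p] g(1)]) (auto simp: U_def)
  have vz0: "v z0 = \<zeta>0" using g(2)[OF \<zeta>D] \<zeta>0 by (simp add: v_def)
  obtain m :: real where m: "m \<ge> 1" "z0 * deriv v z0 = of_real m * v z0"
  proof (rule Jack_lemma[OF holv \<open>open U\<close>])
    show "cball 0 (norm z0) \<subseteq> U"
    proof
      fix z :: complex assume "z \<in> cball 0 (norm z0)"
      then show "z \<in> U" using insidec[of z] z0D r unfolding U_def by force
    qed
    show "v 0 = 0" using g(2)[of 0] \<open>p 0 = q 0\<close> by (simp add: v_def)
    show "norm (v z) < norm (v z0)" if z: "norm z < norm z0" for z
    proof -
      obtain y where "norm y < r" "p z = q y" using inside[OF z] by auto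
      then show ?thesis using g(2)[of y] r \<zeta>r vz0 by (simp add: v_def)
    qed
  qed (use \<open>z0 \<noteq> 0\<close> in auto)
  have "(v has_field_derivative (inverse (deriv q \<zeta>0) * deriv p z0)) (at z0)"
    unfolding v_def
    using holomorphic_derivI[OF p open_ball z0D] g(4)[OF \<zeta>D] \<zeta>0
    by (intro DERIV_chain) auto
  then have "deriv v z0 = inverse (deriv q \<zeta>0) * deriv p z0" by (rule DERIV_imp_deriv)
  then have "z0 * deriv p z0 = z0 * deriv v z0 * deriv q \<zeta>0"
    using g(3)[OF \<zeta>D] by simp
  then have "z0 * deriv p z0 = of_real m * (\<zeta>0 * deriv q \<zeta>0)"
    using m(2) vz0 by simp
  then show thesis using that \<open>z0 \<noteq> 0\<close> z0r \<zeta>r \<zeta>0 m(1) by simp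
qed

subsection \<open>Convex univalent functions\<close>

text \<open>
  With \<open>c = z / \<zeta>\<close>, the function \<open>(1 - t) q(x) + t q(cx)\<close> takes its values in the convex image
  of \<open>q\<close>, so the Schwarz lemma keeps \<open>q\<^sup>-\<^sup>1((1 - t) q(\<zeta>) + t q(z))\<close> in the disc of radius \<open>|\<zeta>|\<close>;
  the inequality is its first-order condition at \<open>t = 0\<close>.
\<close>

lemma convex_univalent_support:
  assumes cu: "convex_univalent q" and z: "norm z \<le> norm \<zeta>" and \<zeta>: "\<zeta> \<in> unit_disc"
  shows "Re (\<zeta> * deriv q \<zeta> / (q \<zeta> - q z)) \<ge> 0"
proof (cases "\<zeta> = 0")
  case False
  have q: "univalent q" and holq: "q holomorphic_on unit_disc" and conv: "convex (q ` unit_disc)"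
    using cu by (auto simp: convex_univalent_def univalent_def)
  define g where "g = the_inv_into unit_disc q"
  note g = univalent_inverse[OF q, folded g_def]
  define c where "c = z / \<zeta>"
  have c: "norm c \<le> 1" "c * \<zeta> = z" using z False by (auto simp: c_def norm_divide)
  have cD: "c * x \<in> unit_disc" if "x \<in> unit_disc" for x
    using that c mult_right_mono[of "norm c" 1 "norm x"] by (auto simp: norm_mult)
  have holc: "(\<lambda>x. q (c * x)) holomorphic_on unit_disc"
  proof -
    have "q \<circ> (\<lambda>x. c * x) holomorphic_on unit_disc"
      by (rule holomorphic_on_compose_gen[OF _ holq]) (use cD in \<open>auto intro!: holomorphic_intros\<close>)
    then show ?thesis by (simp add: o_def)
  qed
  have bound: "norm (g (q \<zeta> + of_real t * (q z - q \<zeta>))) \<le> norm \<zeta>" if t: "0 < t" "t < 1" for t :: real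
  proof -
    have "(\<lambda>x. q x + of_real t * (q (c * x) - q x)) \<prec> q"
    proof (rule subordinate_univalentI[OF q])
      show "(\<lambda>x. q x + of_real t * (q (c * x) - q x)) ` unit_disc \<subseteq> q ` unit_disc"
      proof safe
        fix x :: complex assume x: "x \<in> unit_disc"
        have "(1 - t) *\<^sub>R q x + t *\<^sub>R q (c * x) \<in> q ` unit_disc"
          by (rule convexD[OF conv]) (use x cD t in auto)
        then show "q x + of_real t * (q (c * x) - q x) \<in> q ` unit_disc"
          by (simp add: scaleR_conv_of_real algebra_simps)
      qed
    qed (auto intro!: holomorphic_intros holq holc)
    from subordinate_Schwarz[OF this \<zeta>] obtain y where
      "norm y \<le> norm \<zeta>" "q \<zeta> + of_real t * (q z - q \<zeta>) = q y"
      unfolding c(2) by metis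
    then show ?thesis using g(2)[of y] \<zeta> by simp
  qed
  have "((\<lambda>x. g x / \<zeta>) has_field_derivative inverse (deriv q \<zeta>) / \<zeta>) (at (q \<zeta>))"
    by (rule DERIV_cdivide[OF g(4)[OF \<zeta>]])
  then have "((\<lambda>t::real. Re (g (q \<zeta> + of_real t * (q z - q \<zeta>)) / \<zeta>)) has_real_derivative
      Re (inverse (deriv q \<zeta>) / \<zeta> * (q z - q \<zeta>))) (at 0)"
    by (rule Re_has_derivative_along_line)
  then have "Re (inverse (deriv q \<zeta>) / \<zeta> * (q z - q \<zeta>)) \<le> 0"
  proof (rule DERIV_right_max_nonpos)
    fix t :: real assume t: "0 < t" "t < 1"
    have "norm (g (q \<zeta> + of_real t * (q z - q \<zeta>)) / \<zeta>) \<le> 1"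
      using bound[OF t] False by (simp add: norm_divide)
    then show "Re (g (q \<zeta> + of_real t * (q z - q \<zeta>)) / \<zeta>) \<le> Re (g (q \<zeta> + of_real 0 * (q z - q \<zeta>)) / \<zeta>)"
      using complex_Re_le_cmod[of "g (q \<zeta> + of_real t * (q z - q \<zeta>)) / \<zeta>"] g(2)[OF \<zeta>] False by simp
  qed
  \<comment> \<open>Inversion preserves the sign of the real part, so the bound passes to the
    quotient claimed.\<close>
  moreover have "inverse (deriv q \<zeta>) / \<zeta> * (q z - q \<zeta>) = - inverse (\<zeta> * deriv q \<zeta> / (q \<zeta> - q z))"
    by (simp add: divide_inverse algebra_simps)
  ultimately have "Re (inverse (\<zeta> * deriv q \<zeta> / (q \<zeta> - q z))) \<ge> 0"
    by simp
  then show ?thesis by (simp only: Re_inverse_nonneg_iff)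
qed simp

text \<open>The quotient is a sum of two support quotients with the roles of \<open>z\<close> and
  \<open>\<zeta>\<close> exchanged; equal moduli make both of them available.\<close>

lemma convex_univalent_equal_modulus:
  assumes "convex_univalent q" "norm z = norm \<zeta>" "\<zeta> \<in> unit_disc"
  shows "Re ((\<zeta> * deriv q \<zeta> - z * deriv q z) / (q \<zeta> - q z)) \<ge> 0"
proof -
  have "(\<zeta> * deriv q \<zeta> - z * deriv q z) / (q \<zeta> - q z) =
        \<zeta> * deriv q \<zeta> / (q \<zeta> - q z) + z * deriv q z / (q z - q \<zeta>)"
    by (simp add: diff_divide_distrib minus_divide_right)
  then show ?thesis
    using convex_univalent_support[of q z \<zeta>] convex_univalent_support[of q \<zeta> z] assms by auto
qed

text \<open>
  The quotient is \<open>1 + \<zeta> q''(\<zeta>) / q'(\<zeta>)\<close>, obtained from the preceding inequality as \<open>z\<close> tends to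
  \<open>\<zeta>\<close> along the circle.
\<close>

lemma convex_univalent_deriv:
  assumes cu: "convex_univalent q" and \<zeta>: "\<zeta> \<in> unit_disc"
  shows "Re (deriv (\<lambda>z. z * deriv q z) \<zeta> / deriv q \<zeta>) \<ge> 0"
proof -
  define K where "K = (\<lambda>z. z * deriv q z)"
  have q: "univalent q" and holq: "q holomorphic_on unit_disc"
    using cu by (auto simp: convex_univalent_def univalent_def)
  have q'0: "deriv q \<zeta> \<noteq> 0" by (rule univalent_inverse(3)[OF q \<zeta>])
  have dq: "(q has_field_derivative deriv q \<zeta>) (at \<zeta>)"
    by (rule holomorphic_derivI[OF holq open_ball \<zeta>])
  have holq': "deriv q holomorphic_on unit_disc" by (rule holomorphic_deriv[OF holq open_ball])
  have holK: "K holomorphic_on unit_disc"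
    unfolding K_def by (intro holomorphic_on_mult holomorphic_on_ident holq')
  have dK: "(K has_field_derivative deriv K \<zeta>) (at \<zeta>)"
    by (rule holomorphic_derivI[OF holK open_ball \<zeta>])
  show ?thesis
  proof (cases "\<zeta> = 0")
    \<comment> \<open>The circle through \<open>\<zeta>\<close> degenerates to a point, so the
      quotient is computed directly; it is \<open>1\<close>.\<close>
    case True
    have "(K has_field_derivative deriv q 0) (at 0)"
      unfolding K_def
      by (rule DERIV_cong[OF DERIV_mult'[OF DERIV_ident holomorphic_derivI[OF holq' open_ball]]])
        auto
    then have "deriv K 0 = deriv q 0" by (rule DERIV_imp_deriv)
    then show ?thesis using True q'0 by (simp flip: K_def)
  next
    case False
    have lim: "filterlim (\<lambda>t. \<zeta> * cis t) (at \<zeta>) (at_right 0)"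
    proof (rule filterlim_atI)
      have "((\<lambda>t. \<zeta> * cis t) \<longlongrightarrow> \<zeta> * cis 0) (at_right 0)"
        by (intro tendsto_intros)
      then show "((\<lambda>t. \<zeta> * cis t) \<longlongrightarrow> \<zeta>) (at_right 0)" by simp
      have "\<zeta> * cis t \<noteq> \<zeta>" if "0 < t" "t < pi" for t
      proof -
        have "cis t \<noteq> 1" using sin_gt_zero[OF that] by (auto simp: complex_eq_iff)
        then show ?thesis using False by simp
      qed
      then show "\<forall>\<^sub>F t in at_right 0. \<zeta> * cis t \<noteq> \<zeta>"
        using pi_gt_zero by (auto simp: eventually_at_right_field intro!: exI[of _ pi])
    qed
    have "((\<lambda>z. (K z - K \<zeta>) / (z - \<zeta>) / ((q z - q \<zeta>) / (z - \<zeta>))) \<longlongrightarrow> deriv K \<zeta> / deriv q \<zeta>) (at \<zeta>)"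
      using dK dq q'0 by (intro tendsto_divide) (auto simp: has_field_derivative_iff)
    then have "((\<lambda>z. (K z - K \<zeta>) / (q z - q \<zeta>)) \<longlongrightarrow> deriv K \<zeta> / deriv q \<zeta>) (at \<zeta>)"
      by (rule Lim_transform_within[OF _ zero_less_one]) auto
    from filterlim_compose[OF this lim]
    have "((\<lambda>t. Re ((K (\<zeta> * cis t) - K \<zeta>) / (q (\<zeta> * cis t) - q \<zeta>))) \<longlongrightarrow> Re (deriv K \<zeta> / deriv q \<zeta>)) (at_right 0)"
      by (rule tendsto_Re)
    then show ?thesis unfolding K_def
    proof (rule tendsto_lowerbound)
      show "\<forall>\<^sub>F t in at_right 0. 0 \<le> Re ((\<zeta> * cis t * deriv q (\<zeta> * cis t) - \<zeta> * deriv q \<zeta>) / (q (\<zeta> * cis t) - q \<zeta>))"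
        using \<zeta> by (intro always_eventually allI convex_univalent_equal_modulus[OF cu]) (auto simp: norm_mult)
    qed simp
  qed
qed

text \<open>
  For unequal moduli the two support inequalities do not apply to both terms; instead \<open>K \<circ> q\<^sup>-\<^sup>1\<close>,
  \<open>K(z) = z q'(z)\<close>, has a derivative with nonnegative real part on the convex image of \<open>q\<close>.
\<close>

lemma convex_univalent_monotone:
  assumes cu: "convex_univalent q" and z: "z \<in> unit_disc" and \<zeta>: "\<zeta> \<in> unit_disc"
  shows "Re ((\<zeta> * deriv q \<zeta> - z * deriv q z) / (q \<zeta> - q z)) \<ge> 0"
proof (cases "q \<zeta> = q z")
  case False
  define K where "K = (\<lambda>z. z * deriv q z)"
  have q: "univalent q" and holq: "q holomorphic_on unit_disc" and conv: "convex (q ` unit_disc)"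
    using cu by (auto simp: convex_univalent_def univalent_def)
  have holK: "K holomorphic_on unit_disc"
    unfolding K_def
    by (intro holomorphic_on_mult holomorphic_on_ident holomorphic_deriv[OF holq open_ball])
  define g where "g = the_inv_into unit_disc q"
  note g = univalent_inverse[OF q, folded g_def]
  define d where "d = q \<zeta> - q z"
  have d: "d \<noteq> 0" using False by (simp add: d_def)
  \<comment> \<open>\<open>\<phi>\<close> follows \<open>K \<circ> g\<close> along the segment from
    \<open>q z\<close> to \<open>q \<zeta>\<close>. Division by the direction \<open>d\<close> makes
    its derivative \<open>Re (K' / q')\<close> and makes \<open>\<phi> 1 - \<phi> 0\<close> the real
    part claimed.\<close>
  define \<phi> where "\<phi> = (\<lambda>t::real. Re (K (g (q z + t *\<^sub>R d)) / d))"
  have "\<phi> 0 \<le> \<phi> 1"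
  proof (rule DERIV_nonneg_imp_nondecreasing[where f=\<phi> and a=0 and b=1])
    fix t :: real assume t: "0 \<le> t" "t \<le> 1"
    have "(1 - t) *\<^sub>R q z + t *\<^sub>R q \<zeta> \<in> q ` unit_disc"
      by (rule convexD[OF conv]) (use z \<zeta> t in auto)
    then obtain x where x: "x \<in> unit_disc" "q z + t *\<^sub>R d = q x"
      by (auto simp: d_def algebra_simps)
    have "((\<lambda>y. K (g y)) has_field_derivative deriv K x * inverse (deriv q x)) (at (q x))"
      using holomorphic_derivI[OF holK open_ball x(1)] g(2,4)[OF x(1)]
      by (intro DERIV_chain2) auto
    then have "((\<lambda>y. K (g y) / d) has_field_derivative deriv K x * inverse (deriv q x) / d) (at (q z + t *\<^sub>R d))"
      unfolding x(2) by (rule DERIV_cdivide)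
    moreover have "((\<lambda>t. q z + t *\<^sub>R d) has_vector_derivative d) (at t)"
      by (auto intro!: derivative_eq_intros)
    ultimately have "(\<phi> has_real_derivative Re (deriv K x * inverse (deriv q x) / d * d)) (at t)"
      unfolding \<phi>_def by (rule Re_has_derivative_along_curve)
    moreover have "deriv K x * inverse (deriv q x) / d * d = deriv K x / deriv q x"
      using d by (simp add: divide_inverse)
    then have "Re (deriv K x * inverse (deriv q x) / d * d) \<ge> 0"
      using convex_univalent_deriv[OF cu x(1)] by (simp only: K_def)
    ultimately show "\<exists>y. (\<phi> has_real_derivative y) (at t) \<and> 0 \<le> y" by blast
  qed simp
  then show ?thesis
    using g(2)[OF z] g(2)[OF \<zeta>]
    by (simp add: \<phi>_def d_def K_def diff_divide_distrib)
qed simp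

subsection \<open>The operator \<open>\<Psi>\<close> at a convex univalent function\<close>

locale convex_Psi =
  fixes \<alpha> :: complex and q :: "complex \<Rightarrow> complex"
  assumes \<alpha>: "\<alpha> \<noteq> 0" and cu: "convex_univalent q"
    and pos: "\<And>z. z \<in> unit_disc \<Longrightarrow> Re ((1 - \<alpha>) / \<alpha> + 2 * q z) > 0"
begin

abbreviation "h \<equiv> Psi \<alpha> q"
abbreviation "K z \<equiv> z * deriv q z"

lemma univq: "univalent q" and holq: "q holomorphic_on unit_disc" and injq: "inj_on q unit_disc"
  using cu by (auto simp: convex_univalent_def univalent_def)

lemma holK: "(\<lambda>z. K z) holomorphic_on unit_disc"
  by (intro holomorphic_on_mult holomorphic_on_ident holomorphic_deriv[OF holq open_ball])

lemma holh: "h holomorphic_on unit_disc"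
  unfolding Psi_def by (intro holomorphic_intros holomorphic_deriv[OF holq] holq) auto

lemma deriv_q_nonzero: "z \<in> unit_disc \<Longrightarrow> deriv q z \<noteq> 0"
  by (rule univalent_inverse(3)[OF univq])

text \<open>The mean of the hypothesis at \<open>z\<close> and at \<open>\<zeta>\<close>.\<close>

lemma pos_sum:
  assumes "z \<in> unit_disc" "\<zeta> \<in> unit_disc"
  shows "Re ((1 - \<alpha>) / \<alpha> + q \<zeta> + q z) > 0"
  using pos[OF assms(1)] pos[OF assms(2)] by simp

lemma Psi_diff: "h \<zeta> - h z = \<alpha> * ((q \<zeta> - q z) * ((1 - \<alpha>) / \<alpha> + q \<zeta> + q z) + (K \<zeta> - K z))"
proof -
  have "\<alpha> * (q \<zeta>)\<^sup>2 + b * q \<zeta> + \<alpha> * \<zeta> * deriv q \<zeta> - (\<alpha> * (q z)\<^sup>2 + b * q z + \<alpha> * z * deriv q z) =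
      \<alpha> * ((q \<zeta> - q z) * (c + q \<zeta> + q z) + (K \<zeta> - K z))" if "b = \<alpha> * c" for b c
    unfolding that by (simp add: algebra_simps power2_eq_square)
  from this[of "1 - \<alpha>" "(1 - \<alpha>) / \<alpha>"] show ?thesis using \<alpha> by (simp add: Psi_def)
qed

text \<open>By \<open>Psi_diff\<close> the quotient is the positive term of \<open>pos_sum\<close>
  plus the monotonicity quotient of \<open>K\<close>. Its not vanishing makes \<open>h\<close>
  injective.\<close>

lemma Psi_diff_quotient:
  assumes z: "z \<in> unit_disc" and \<zeta>: "\<zeta> \<in> unit_disc" and "z \<noteq> \<zeta>"
  shows "Re ((h \<zeta> - h z) / (\<alpha> * (q \<zeta> - q z))) > 0"
proof -
  have "q \<zeta> - q z \<noteq> 0" using injq assms by (auto dest: inj_onD)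
  then have "(h \<zeta> - h z) / (\<alpha> * (q \<zeta> - q z)) =
      ((1 - \<alpha>) / \<alpha> + q \<zeta> + q z) + (K \<zeta> - K z) / (q \<zeta> - q z)"
    using \<alpha> unfolding Psi_diff by (simp add: add_divide_distrib)
  then show ?thesis using pos_sum[OF z \<zeta>] convex_univalent_monotone[OF cu z \<zeta>] by simp
qed

lemma univalent_Psi: "univalent h"
  unfolding univalent_def
proof
  show "inj_on h unit_disc"
  proof (rule inj_onI, rule ccontr)
    fix z \<zeta> assume "z \<in> unit_disc" "\<zeta> \<in> unit_disc" "h z = h \<zeta>" "z \<noteq> \<zeta>"
    then show False using Psi_diff_quotient[of z \<zeta>] by simp
  qed
qed (rule holh)

text \<open>At a meeting point the quotient of \<open>Psi_diff_quotient\<close> would be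
  \<open>- s\<close> times a support quotient, whose real part is nonnegative.\<close>

lemma outer_ray_avoids_Psi:
  assumes z: "norm z < norm \<zeta>" and \<zeta>: "\<zeta> \<in> unit_disc" and s: "s \<ge> 0"
  shows "h \<zeta> + of_real s * (\<alpha> * K \<zeta>) \<noteq> h z"
proof
  assume "h \<zeta> + of_real s * (\<alpha> * K \<zeta>) = h z"
  then have eq: "h \<zeta> - h z = - of_real s * (\<alpha> * K \<zeta>)" by (simp add: algebra_simps)
  have zD: "z \<in> unit_disc" and ne: "z \<noteq> \<zeta>" using z \<zeta> by auto
  have "(h \<zeta> - h z) / (\<alpha> * (q \<zeta> - q z)) = of_real (- s) * (K \<zeta> / (q \<zeta> - q z))"
    unfolding eq using \<alpha> by simp
  then have "Re ((h \<zeta> - h z) / (\<alpha> * (q \<zeta> - q z))) = - s * Re (K \<zeta> / (q \<zeta> - q z))"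
    by (simp only: times_complex.sel Re_complex_of_real Im_complex_of_real mult_zero_left diff_0_right)
  moreover have "s * Re (K \<zeta> / (q \<zeta> - q z)) \<ge> 0"
    using convex_univalent_support[OF cu _ \<zeta>, of z] z s by simp
  ultimately show False using Psi_diff_quotient[OF zD \<zeta> ne] by simp
qed

lemma subordinate_of_Psi_subordinate:
  assumes p: "p holomorphic_on unit_disc" and p0: "p 0 = q 0" and sub: "Psi \<alpha> p \<prec> h"
  shows "p \<prec> q"
proof (rule subordinate_univalentI[OF univq p _ p0], rule univalent_subset_if_balls, rule ccontr)
  fix r :: real assume r: "0 < r" "r < 1" and out: "\<not> p ` ball 0 r \<subseteq> q ` ball 0 r"
  show False
  proof (rule first_exit_point[OF p univq p0 r out])
    fix z0 \<zeta>0 and m :: real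
    assume *: "0 < norm z0" "norm z0 < r" "norm \<zeta>0 = r" "p z0 = q \<zeta>0" "m \<ge> 1"
      "z0 * deriv p z0 = of_real m * K \<zeta>0"
    \<comment> \<open>As \<open>p z0 = q \<zeta>0\<close>, only the derivative terms differ, by the
      factor \<open>m\<close>.\<close>
    have "Psi \<alpha> p z0 = h \<zeta>0 + of_real (m - 1) * (\<alpha> * K \<zeta>0)"
      unfolding Psi_def mult.assoc *(4,6) by (simp add: algebra_simps)
    moreover obtain y where "norm y \<le> norm z0" "Psi \<alpha> p z0 = h y"
      using subordinate_Schwarz[OF sub, of z0] * r by auto
    ultimately show False using outer_ray_avoids_Psi[of y \<zeta>0 "m - 1"] * r by auto
  qed
qed

section \<open>Inner segments and the lower subordination\<close>

lemma deriv_Psi_quotient: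
  assumes \<zeta>: "\<zeta> \<in> unit_disc"
  shows "Re (deriv h \<zeta> / (\<alpha> * deriv q \<zeta>)) > 0"
proof -
  have "(h has_field_derivative
      \<alpha> * (2 * q \<zeta> * deriv q \<zeta>) + (1 - \<alpha>) * deriv q \<zeta> + \<alpha> * deriv (\<lambda>z. K z) \<zeta>) (at \<zeta>)"
    unfolding Psi_def mult.assoc
    by (rule derivative_eq_intros holomorphic_derivI[OF holq open_ball \<zeta>]
        holomorphic_derivI[OF holK open_ball \<zeta>] refl | simp)+
  then have "deriv h \<zeta> = \<alpha> * (2 * q \<zeta> * deriv q \<zeta>) + (1 - \<alpha>) * deriv q \<zeta> + \<alpha> * deriv (\<lambda>z. K z) \<zeta>"
    by (rule DERIV_imp_deriv)
  \<comment> \<open>The infinitesimal form of \<open>Psi_diff_quotient\<close>.\<close>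
  then have "deriv h \<zeta> / (\<alpha> * deriv q \<zeta>) =
      ((1 - \<alpha>) / \<alpha> + 2 * q \<zeta>) + deriv (\<lambda>z. K z) \<zeta> / deriv q \<zeta>"
    using \<alpha> deriv_q_nonzero[OF \<zeta>] by (simp add: add_divide_distrib)
  then show ?thesis using pos[OF \<zeta>] convex_univalent_deriv[OF cu \<zeta>] by simp
qed

text \<open>Along the segment the squared modulus of \<open>g / \<zeta>\<close>, with
  \<open>g\<close> the inverse of \<open>h\<close>, starts at \<open>1\<close> with derivative
  \<open>-2 Re (\<alpha> q' / h')\<close>, which is negative by
  \<open>deriv_Psi_quotient\<close>.\<close>

lemma inner_ray_enters_Psi:
  assumes \<zeta>: "\<zeta> \<in> unit_disc" and "\<zeta> \<noteq> 0"
  obtains t :: real where "0 < t" "t \<le> 1" "h \<zeta> - of_real t * (\<alpha> * K \<zeta>) \<in> h ` ball 0 (norm \<zeta>)"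
proof -
  define g where "g = the_inv_into unit_disc h"
  note g = univalent_inverse[OF univalent_Psi, folded g_def]
  define F where "F = (\<lambda>w. g w / \<zeta>)"
  define v where "v = - (\<alpha> * K \<zeta>)"
  define D where "D = inverse (deriv h \<zeta>) / \<zeta>"
  have dF: "(F has_field_derivative D) (at (h \<zeta>))"
    unfolding F_def D_def by (rule DERIV_cdivide[OF g(4)[OF \<zeta>]])
  have F0: "F (h \<zeta>) = 1" using g(2)[OF \<zeta>] \<open>\<zeta> \<noteq> 0\<close> by (simp add: F_def)
  have "((\<lambda>t. Re (F (h \<zeta> + of_real t * v))) has_real_derivative Re (D * v)) (at 0)"
    by (rule Re_has_derivative_along_line[OF dF])
  moreover have "((\<lambda>t. Im (F (h \<zeta> + of_real t * v))) has_real_derivative Re (- \<i> * D * v)) (at 0)"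
    using Re_has_derivative_along_line[OF DERIV_cmult[OF dF], of "- \<i>" v] by simp
  \<comment> \<open>Since \<open>F\<close> equals \<open>1\<close> at the start, the imaginary part
    contributes nothing to the derivative.\<close>
  moreover have sq: "((\<lambda>t. (X t)\<^sup>2 + (Y t)\<^sup>2) has_real_derivative 2 * a) (at 0)"
    if "(X has_real_derivative a) (at 0)" "(Y has_real_derivative b) (at 0)" "X 0 = 1" "Y 0 = 0"
    for X Y :: "real \<Rightarrow> real" and a b
    using that by (auto intro!: derivative_eq_intros)
  ultimately have dN: "((\<lambda>t. (Re (F (h \<zeta> + of_real t * v)))\<^sup>2 + (Im (F (h \<zeta> + of_real t * v)))\<^sup>2)
      has_real_derivative 2 * Re (D * v)) (at 0)"
    using F0 by (intro sq) auto
  have "D * v = - inverse (deriv h \<zeta> / (\<alpha> * deriv q \<zeta>))"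
    using \<open>\<zeta> \<noteq> 0\<close> by (simp add: D_def v_def divide_inverse)
  then have "Re (D * v) = - Re (inverse (deriv h \<zeta> / (\<alpha> * deriv q \<zeta>)))"
    by (simp only: uminus_complex.sel)
  moreover have "Re (inverse (deriv h \<zeta> / (\<alpha> * deriv q \<zeta>))) > 0"
    using deriv_Psi_quotient[OF \<zeta>] by (simp only: Re_inverse_pos_iff)
  ultimately have "2 * Re (D * v) < 0" by linarith
  from DERIV_neg_dec_right[OF dN this] obtain d where d: "d > 0"
    "\<And>t. 0 < t \<Longrightarrow> t < d \<Longrightarrow> (norm (F (h \<zeta> + of_real t * v)))\<^sup>2 < 1"
    using F0 by (auto simp: cmod_power2)
  obtain e where e: "e > 0" "ball (h \<zeta>) e \<subseteq> h ` unit_disc"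
    using g(5) \<zeta> by (meson imageI openE)
  \<comment> \<open>Small enough for the modulus to have decreased and for the point to lie in the
    image of \<open>h\<close>; the summand \<open>1\<close> keeps the denominator positive.\<close>
  define t where "t = min (d / 2) (min 1 (e / (norm v + 1) / 2))"
  have pe: "0 < e / (norm v + 1) / 2" using e(1) by (simp add: add_nonneg_pos)
  then have "0 < t" using d(1) by (simp add: t_def)
  moreover have "t \<le> d / 2" unfolding t_def by (rule min.cobounded1)
  moreover have "t \<le> 1" by (simp add: t_def)
  ultimately have t: "0 < t" "t < d" "t \<le> 1" using d(1) by linarith+
  have "t * norm v < e"
  proof -
    have "t \<le> e / (norm v + 1) / 2" by (auto simp: t_def)
    also have "\<dots> < e / (norm v + 1)" using pe by linarith
    finally have "t * (norm v + 1) < e" by (simp add: pos_less_divide_eq add_nonneg_pos)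
    then show ?thesis using t(1) by (simp add: algebra_simps)
  qed
  then have "h \<zeta> + of_real t * v \<in> ball (h \<zeta>) e"
    using t by (simp add: dist_norm norm_mult)
  then obtain x where x: "x \<in> unit_disc" "h \<zeta> + of_real t * v = h x" using e(2) by auto
  have "(norm (F (h x)))\<^sup>2 < 1\<^sup>2" using d(2)[OF t(1,2)] x(2) by simp
  then have "norm (F (h x)) < 1" by (rule power2_less_imp_less) simp
  then have "norm x < norm \<zeta>"
    using g(2)[OF x(1)] \<open>\<zeta> \<noteq> 0\<close> by (simp add: F_def norm_divide divide_simps)
  moreover have "h \<zeta> - of_real t * (\<alpha> * K \<zeta>) = h x" using x(2) by (simp add: v_def)
  ultimately show thesis using that t by auto
qed

text \<open>Solving an equality for the expression of \<open>pos_sum\<close> gives minus a sum of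
  two support quotients, the first weighted by \<open>1 - s \<ge> 0\<close>, contradicting
  positivity. The case \<open>z = \<zeta>\<close> is excluded by \<open>s > 0\<close>.\<close>

lemma inner_ray_avoids_circle:
  assumes \<zeta>: "\<zeta> \<in> unit_disc" "\<zeta> \<noteq> 0" and z: "norm z = norm \<zeta>" and s: "0 < s" "s \<le> 1"
  shows "h \<zeta> - of_real s * (\<alpha> * K \<zeta>) \<noteq> h z"
proof
  assume eq: "h \<zeta> - of_real s * (\<alpha> * K \<zeta>) = h z"
  have zD: "z \<in> unit_disc" using z \<zeta> by simp
  have "z \<noteq> \<zeta>" using eq \<alpha> deriv_q_nonzero[OF \<zeta>(1)] \<zeta>(2) s by auto
  then have ne: "q \<zeta> - q z \<noteq> 0" using injq zD \<zeta> by (auto dest: inj_onD)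
  define B where "B = (1 - \<alpha>) / \<alpha> + q \<zeta> + q z"
  have "\<alpha> * ((q \<zeta> - q z) * B + (K \<zeta> - K z)) = \<alpha> * (of_real s * K \<zeta>)"
    using eq Psi_diff[of \<zeta> z] by (simp add: B_def algebra_simps)
  then have "(q \<zeta> - q z) * B + (K \<zeta> - K z) = of_real s * K \<zeta>"
    using \<alpha> mult_left_cancel by blast
  then have "B = (of_real s * K \<zeta> - (K \<zeta> - K z)) / (q \<zeta> - q z)"
    using ne by (simp add: eq_divide_eq algebra_simps)
  also have "\<dots> = - (of_real (1 - s) * (K \<zeta> / (q \<zeta> - q z)) + K z / (q z - q \<zeta>))"
  proof -
    have "(of_real s * a - (a - b)) / d = - (of_real (1 - s) * (a / d) + b / (- d))" for a b d :: complex
      by (simp add: diff_divide_distrib add_divide_distrib algebra_simps)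
    from this[of "K \<zeta>" "K z" "q \<zeta> - q z"] show ?thesis by (simp only: minus_diff_eq)
  qed
  finally have "Re B = - ((1 - s) * Re (K \<zeta> / (q \<zeta> - q z)) + Re (K z / (q z - q \<zeta>)))"
    by (simp only: uminus_complex.sel plus_complex.sel Re_complex_of_real times_complex.sel Im_complex_of_real)
  moreover have "(1 - s) * Re (K \<zeta> / (q \<zeta> - q z)) \<ge> 0"
    using convex_univalent_support[OF cu, of z \<zeta>] z \<zeta> s by (intro mult_nonneg_nonneg) auto
  moreover have "Re (K z / (q z - q \<zeta>)) \<ge> 0"
    using convex_univalent_support[OF cu, of \<zeta> z] z zD by auto
  ultimately show False using pos_sum[OF zD \<zeta>(1)] by (simp add: B_def)
qed

text \<open>
  The segment without its initial point is connected, enters the image of the open disc and never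
  meets the image of the circle.
\<close>

lemma inner_ray_in_Psi:
  assumes \<zeta>: "\<zeta> \<in> unit_disc" and s: "0 \<le> s" "s \<le> 1"
  shows "h \<zeta> - of_real s * (\<alpha> * K \<zeta>) \<in> h ` cball 0 (norm \<zeta>)"
proof (cases "s = 0 \<or> \<zeta> = 0")
  case True
  then show ?thesis by auto
next
  case False
  then have s0: "0 < s" and \<zeta>0: "\<zeta> \<noteq> 0" using s by auto
  define \<gamma> where "\<gamma> = (\<lambda>s. h \<zeta> - of_real s * (\<alpha> * K \<zeta>))"
  have sub: "ball 0 (norm \<zeta>) \<subseteq> unit_disc" "cball 0 (norm \<zeta>) \<subseteq> unit_disc" using \<zeta> by auto
  have open1: "open (h ` ball 0 (norm \<zeta>))"
    using holh univalent_Psi sub(1)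
    by (intro open_mapping_thm3) (auto simp: univalent_def intro: holomorphic_on_subset inj_on_subset)
  have open2: "open (- h ` cball 0 (norm \<zeta>))"
    using holomorphic_on_imp_continuous_on[OF holh] sub(2)
    by (intro open_Compl compact_imp_closed compact_continuous_image) (auto intro: continuous_on_subset)
  \<comment> \<open>The interval is half-open because \<open>\<gamma> 0 = h \<zeta>\<close> lies on
    the image of the circle, hence in neither of the two open sets.\<close>
  have conn: "connected (\<gamma> ` {0<..1})"
    unfolding \<gamma>_def by (intro connected_continuous_image continuous_intros) auto
  have cover: "\<gamma> ` {0<..1} \<subseteq> h ` ball 0 (norm \<zeta>) \<union> - h ` cball 0 (norm \<zeta>)"
  proof (rule image_subsetI)
    fix u :: real assume "u \<in> {0<..1}"
    then have u: "0 < u" "u \<le> 1" by auto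
    show "\<gamma> u \<in> h ` ball 0 (norm \<zeta>) \<union> - h ` cball 0 (norm \<zeta>)"
    proof (rule ccontr)
      assume "\<not> ?thesis"
      then obtain z where "norm z \<le> norm \<zeta>" "\<gamma> u = h z" "\<gamma> u \<notin> h ` ball 0 (norm \<zeta>)" by auto
      moreover from this have "norm z = norm \<zeta>" by force
      ultimately show False
        using inner_ray_avoids_circle[OF \<zeta> \<zeta>0 _ u] by (simp add: \<gamma>_def)
    qed
  qed
  have disj: "h ` ball 0 (norm \<zeta>) \<inter> - h ` cball 0 (norm \<zeta>) \<inter> \<gamma> ` {0<..1} = {}"
  proof -
    have "A \<inter> - B \<inter> C = {}" if "A \<subseteq> B" for A B C :: "complex set" using that by blast
    then show ?thesis by (simp add: image_mono)
  qed
  have "h ` ball 0 (norm \<zeta>) \<inter> \<gamma> ` {0<..1} = {} \<or> - h ` cball 0 (norm \<zeta>) \<inter> \<gamma> ` {0<..1} = {}"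
    by (rule connectedD[OF conn open1 open2 disj cover])
  moreover obtain t where "0 < t" "t \<le> 1" "\<gamma> t \<in> h ` ball 0 (norm \<zeta>)"
    using inner_ray_enters_Psi[OF \<zeta> \<zeta>0] unfolding \<gamma>_def by metis
  then have "h ` ball 0 (norm \<zeta>) \<inter> \<gamma> ` {0<..1} \<noteq> {}" by force
  ultimately have "\<gamma> s \<notin> - h ` cball 0 (norm \<zeta>)" using s s0 by force
  then show ?thesis by (simp add: \<gamma>_def)
qed

lemma subordinate_of_subordinate_Psi:
  assumes p: "univalent p" and Pp: "univalent (Psi \<alpha> p)" and p0: "q 0 = p 0"
    and sub: "h \<prec> Psi \<alpha> p"
  shows "q \<prec> p"
proof (rule subordinate_univalentI[OF p holq _ p0], rule univalent_subset_if_balls, rule ccontr)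
  fix r :: real assume r: "0 < r" "r < 1" and out: "\<not> q ` ball 0 r \<subseteq> p ` ball 0 r"
  show False
  proof (rule first_exit_point[OF holq p p0 r out])
    fix z0 \<zeta>0 and m :: real
    assume *: "0 < norm z0" "norm z0 < r" "norm \<zeta>0 = r" "q z0 = p \<zeta>0" "m \<ge> 1"
      "K z0 = of_real m * (\<zeta>0 * deriv p \<zeta>0)"
    \<comment> \<open>The relation is solved for \<open>p'\<close>: the factor \<open>1 / m\<close>
      gives the segment parameter \<open>1 - 1 / m\<close>, which lies between \<open>0\<close> and
      \<open>1\<close>.\<close>
    have "\<zeta>0 * deriv p \<zeta>0 = K z0 - of_real (1 - 1 / m) * K z0"
      using *(5,6) by (simp add: algebra_simps)
    then have "Psi \<alpha> p \<zeta>0 = h z0 - of_real (1 - 1 / m) * (\<alpha> * K z0)"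
      using *(4) by (simp add: Psi_def mult.assoc right_diff_distrib del: of_real_diff)
    also have "\<dots> \<in> h ` cball 0 (norm z0)"
      by (rule inner_ray_in_Psi) (use * r in auto)
    finally obtain y where y: "norm y \<le> norm z0" "Psi \<alpha> p \<zeta>0 = h y" by auto
    \<comment> \<open>Then \<open>norm x \<le> norm z0 < norm \<zeta>0\<close>, although
      \<open>\<Psi>[p]\<close> takes the same value at \<open>x\<close> and
      \<open>\<zeta>0\<close>.\<close>
    obtain x where x: "norm x \<le> norm y" "h y = Psi \<alpha> p x"
      using subordinate_Schwarz[OF sub, of y] y * r by auto
    then have "x = \<zeta>0"
      using Pp y * r by (auto simp: univalent_def dest!: inj_onD[of _ _ x \<zeta>0])
    then show False using x y * by simp
  qed
qed

section \<open>Best dominant and best subordinant\<close>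

lemma best_dominant_Psi:
  assumes "q 0 = 1"
  shows "best_dominant \<alpha> h q"
  unfolding best_dominant_def dominant_def
proof (intro conjI allI impI)
  fix r assume "univalent r \<and> (\<forall>p. p holomorphic_on unit_disc \<and> p 0 = 1 \<and> Psi \<alpha> p \<prec> h \<longrightarrow> p \<prec> r)"
  \<comment> \<open>Hence \<open>q\<close> itself is an admissible \<open>p\<close>, and every
    dominant is tested against it.\<close>
  moreover have "h \<prec> h" by (rule subordinate_univalentI[OF univalent_Psi holh]) auto
  ultimately show "q \<prec> r" using holq assms by blast
qed (use univq subordinate_of_Psi_subordinate assms in auto)

lemma best_subordinant_Psi:
  assumes "q 0 = 1"
  shows "best_subordinant \<alpha> h q"
  unfolding best_subordinant_def subordinant_def
proof (intro conjI allI impI)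
  fix r assume "r holomorphic_on unit_disc \<and>
    (\<forall>p. p 0 = 1 \<and> univalent p \<and> univalent (Psi \<alpha> p) \<and> h \<prec> Psi \<alpha> p \<longrightarrow> r \<prec> p)"
  \<comment> \<open>Again \<open>q\<close> is an admissible \<open>p\<close>, now also because
    \<open>q\<close> and \<open>h\<close> are univalent.\<close>
  moreover have "h \<prec> h" by (rule subordinate_univalentI[OF univalent_Psi holh]) auto
  ultimately show "r \<prec> q" using univq univalent_Psi assms by blast
qed (use univq holq subordinate_of_subordinate_Psi assms in auto)

end

subsection \<open>The double subordination\<close>

text \<open>Away from \<open>0\<close> and the zeros of \<open>f\<close> and \<open>f'\<close> this
  is the quotient rule. These points are isolated and both sides are continuous, so the identity
  extends to the whole disc.\<close>

lemma middle_expr_eq_Psi: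
  assumes f: "f holomorphic_on unit_disc" "deriv f 0 \<noteq> 0"
    and "open \<Omega>" "f ` unit_disc \<subseteq> \<Omega>" "\<Phi> holomorphic_on \<Omega>"
    and nz: "\<And>\<omega>. \<omega> \<in> f ` unit_disc - {0} \<Longrightarrow> \<Phi> \<omega> \<noteq> 0"
    and P: "quot_expr \<Phi> f holomorphic_on unit_disc"
    and M: "middle_expr \<alpha> \<Phi> f holomorphic_on unit_disc"
    and z: "z \<in> unit_disc"
  shows "middle_expr \<alpha> \<Phi> f z = Psi \<alpha> (quot_expr \<Phi> f) z"
proof -
  have hol\<Phi>f: "(\<lambda>z. \<Phi> (f z)) holomorphic_on unit_disc"
    using holomorphic_on_compose_gen[OF f(1) assms(5,4)] by (simp add: o_def)
  have holf': "deriv f holomorphic_on unit_disc" by (rule holomorphic_deriv[OF f(1) open_ball])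
  have generic: "middle_expr \<alpha> \<Phi> f w = Psi \<alpha> (quot_expr \<Phi> f) w"
    if w: "w \<in> unit_disc" "w \<noteq> 0" "f w \<noteq> 0" "deriv f w \<noteq> 0" for w
  proof -
    have \<Phi>w: "\<Phi> (f w) \<noteq> 0" using nz w by auto
    have at: "f analytic_on {w}" "deriv f analytic_on {w}" "deriv (deriv f) analytic_on {w}"
      "(\<lambda>z. \<Phi> (f z)) analytic_on {w}" "deriv (\<lambda>z. \<Phi> (f z)) analytic_on {w}"
      using w(1) f(1) holf' hol\<Phi>f holomorphic_deriv[OF holf'] holomorphic_deriv[OF hol\<Phi>f]
      by (auto simp: analytic_at intro!: exI[of _ unit_disc])
    define Q where "Q = (\<lambda>z. z * deriv f z / \<Phi> (f z))"
    have Q: "Q analytic_on {w}" unfolding Q_def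
      using at \<Phi>w by (intro analytic_intros) auto
    have "middle_expr \<alpha> \<Phi> f w = Q w * (1 + \<alpha> * w * deriv (deriv f) w / deriv f w
          + \<alpha> * w * (deriv f w - deriv (\<lambda>\<zeta>. \<Phi> (f \<zeta>)) w) / \<Phi> (f w))"
      unfolding middle_expr_def Q_def
      by (rule remove_sings_at_analytic) (use at \<Phi>w w in \<open>auto intro!: analytic_intros\<close>)
    moreover have "(Q has_field_derivative
        ((deriv f w + w * deriv (deriv f) w) * \<Phi> (f w) - w * deriv f w * deriv (\<lambda>\<zeta>. \<Phi> (f \<zeta>)) w)
          / (\<Phi> (f w) * \<Phi> (f w))) (at w)"
      unfolding Q_def
      by (rule derivative_eq_intros holomorphic_derivI[OF holf' open_ball w(1)]
          holomorphic_derivI[OF hol\<Phi>f open_ball w(1)] \<Phi>w refl | simp)+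
    then have "deriv Q w = ((deriv f w + w * deriv (deriv f) w) * \<Phi> (f w) - w * deriv f w * deriv (\<lambda>\<zeta>. \<Phi> (f \<zeta>)) w)
          / (\<Phi> (f w) * \<Phi> (f w))" by (rule DERIV_imp_deriv)
    moreover have "Psi \<alpha> (quot_expr \<Phi> f) w = \<alpha> * (Q w)\<^sup>2 + (1 - \<alpha>) * Q w + \<alpha> * w * deriv Q w"
      using Q by (simp add: Psi_def quot_expr_def Q_def)
    moreover have "w * a / c * (1 + \<alpha> * w * b / a + \<alpha> * w * (a - e) / c) =
        \<alpha> * (w * a / c)\<^sup>2 + (1 - \<alpha>) * (w * a / c) + \<alpha> * w * (((a + w * b) * c - w * a * e) / (c * c))"
      if "a \<noteq> 0" "c \<noteq> 0" for a b c e
      using that by (simp add: field_simps power2_eq_square)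
    ultimately show ?thesis
      using \<Phi>w w(4) by (simp only: Q_def)
  qed
  \<comment> \<open>Neither \<open>f\<close> nor \<open>f'\<close> vanishes identically, as
    \<open>f'(0) \<noteq> 0\<close>; this isolates their zeros.\<close>
  have "\<exists>\<beta>\<in>unit_disc. f \<beta> \<noteq> 0"
  proof (rule ccontr)
    assume "\<not> ?thesis"
    then have "deriv f 0 = deriv (\<lambda>_. 0) 0"
      by (intro deriv_cong_ev) (auto simp: eventually_nhds intro!: exI[of _ unit_disc])
    then show False using f(2) by simp
  qed
  then have "\<forall>\<^sub>F w in at z. f w \<noteq> 0 \<and> w \<in> unit_disc"
    using non_zero_neighbour_alt[OF f(1) open_ball _ z] by auto
  moreover have "\<forall>\<^sub>F w in at z. deriv f w \<noteq> 0 \<and> w \<in> unit_disc"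
    using non_zero_neighbour_alt[OF holf' open_ball _ z _ f(2)] by auto
  moreover have "\<forall>\<^sub>F w in at z. w \<noteq> 0" by (rule eventually_neq_at_within)
  ultimately have ev: "\<forall>\<^sub>F w in at z. middle_expr \<alpha> \<Phi> f w = Psi \<alpha> (quot_expr \<Phi> f) w"
    by eventually_elim (use generic in auto)
  have "Psi \<alpha> (quot_expr \<Phi> f) holomorphic_on unit_disc"
    unfolding Psi_def by (intro holomorphic_intros holomorphic_deriv[OF P] P) auto
  then have "isCont (Psi \<alpha> (quot_expr \<Phi> f)) z" "isCont (middle_expr \<alpha> \<Phi> f) z"
    using M z by (auto intro!: continuous_on_interior[OF holomorphic_on_imp_continuous_on])
  then have "Psi \<alpha> (quot_expr \<Phi> f) \<midarrow>z\<rightarrow> Psi \<alpha> (quot_expr \<Phi> f) z"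
    "Psi \<alpha> (quot_expr \<Phi> f) \<midarrow>z\<rightarrow> middle_expr \<alpha> \<Phi> f z"
    using tendsto_cong[OF ev] by (auto simp: isCont_def)
  then show ?thesis by (metis LIM_unique)
qed

text \<open>The exceptional set lies on the unit circle, so it misses the open disc.\<close>

lemma class_Q_inj_on:
  assumes "f \<in> class_Q"
  shows "inj_on f unit_disc"
proof -
  obtain F where F: "\<forall>z\<in>unit_disc. F z = f z" "inj_on F (cball 0 1 - exceptional_set F)"
    using assms by (auto simp: class_Q_def)
  have "inj_on F unit_disc"
    by (rule inj_on_subset[OF F(2)]) (auto simp: exceptional_set_def)
  then show ?thesis using F(1) by (simp add: inj_on_def)
qed

theorem theorem4p2:
  fixes \<alpha> :: complex
    and q1 q2 h1 h2 f \<Phi> :: "complex \<Rightarrow> complex"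
    and \<Omega> :: "complex set"
  assumes "\<alpha> \<noteq> 0"
    and "convex_univalent q1" and "q1 0 = 1"
    and "convex_univalent q2" and "q2 0 = 1"
    and "h1 = (\<lambda>z. \<alpha> * (q1 z)\<^sup>2 + (1 - \<alpha>) * q1 z + \<alpha> * z * deriv q1 z)"
    and "h2 = (\<lambda>z. \<alpha> * (q2 z)\<^sup>2 + (1 - \<alpha>) * q2 z + \<alpha> * z * deriv q2 z)"
    and "\<And>z. z \<in> unit_disc \<Longrightarrow> Re ((1 - \<alpha>) / \<alpha> + 2 * q1 z) > 0"
    and "\<And>z. z \<in> unit_disc \<Longrightarrow> Re ((1 - \<alpha>) / \<alpha> + 2 * q2 z) > 0"
    and "f \<in> class_A"
    and "open \<Omega>" and "connected \<Omega>" and "f ` unit_disc \<subseteq> \<Omega>"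
    and "\<Phi> holomorphic_on \<Omega>" and "\<Phi> 0 = 0" and "deriv \<Phi> 0 = 1"
    and "\<And>\<omega>. \<omega> \<in> f ` unit_disc - {0} \<Longrightarrow> \<Phi> \<omega> \<noteq> 0"
    and "quot_expr \<Phi> f \<in> class_H11 \<inter> class_Q"
    and "univalent (middle_expr \<alpha> \<Phi> f)"
  shows "(h1 \<prec> middle_expr \<alpha> \<Phi> f \<and> middle_expr \<alpha> \<Phi> f \<prec> h2 \<longrightarrow>
            q1 \<prec> quot_expr \<Phi> f \<and> quot_expr \<Phi> f \<prec> q2) \<and>
         best_subordinant \<alpha> h1 q1 \<and> best_dominant \<alpha> h2 q2"
proof -
  interpret C1: convex_Psi \<alpha> q1 using assms by unfold_locales auto
  interpret C2: convex_Psi \<alpha> q2 using assms by unfold_locales auto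
  have h: "h1 = Psi \<alpha> q1" "h2 = Psi \<alpha> q2" using assms by (auto simp: Psi_def)
  let ?P = "quot_expr \<Phi> f" and ?M = "middle_expr \<alpha> \<Phi> f"
  have P: "?P holomorphic_on unit_disc" "?P 0 = 1" "inj_on ?P unit_disc"
    using assms class_Q_inj_on by (auto simp: class_H11_def)
  have M: "?M holomorphic_on unit_disc" "inj_on ?M unit_disc"
    using assms by (auto simp: univalent_def)
  have eq: "?M z = Psi \<alpha> ?P z" if "z \<in> unit_disc" for z
    using assms P M that by (intro middle_expr_eq_Psi[where \<Omega>=\<Omega>]) (auto simp: class_A_def)
  \<comment> \<open>The lower subordination needs univalence of \<open>\<Psi>[p]\<close>; it is
    carried over from the middle expression.\<close>
  have "univalent (Psi \<alpha> ?P)"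
    unfolding univalent_def
  proof
    show "Psi \<alpha> ?P holomorphic_on unit_disc" by (rule holomorphic_transform[OF M(1) eq])
    show "inj_on (Psi \<alpha> ?P) unit_disc" using M(2) eq by (simp add: inj_on_def)
  qed
  then have "h1 \<prec> ?M \<Longrightarrow> q1 \<prec> ?P"
    using C1.subordinate_of_subordinate_Psi[of ?P] P assms(3) subordinate_cong[of h1 h1 ?M "Psi \<alpha> ?P"] eq
    by (simp add: univalent_def h)
  moreover have "?M \<prec> h2 \<Longrightarrow> ?P \<prec> q2"
    using C2.subordinate_of_Psi_subordinate[of ?P] P assms(5) subordinate_cong[of ?M "Psi \<alpha> ?P" h2 h2] eq
    by (simp add: h)
  ultimately show ?thesis
    using C1.best_subordinant_Psi C2.best_dominant_Psi assms(3,5) by (simp add: h)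
qed

end
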